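(* Let $\mathcal{P}$ be an uncertain POMDP with finite state set $Q$, finite action set $A$, observation set $Z$, uncertain triplets $T_u$ with interval bounds $\underline{l}_{q,a,q'},\overline{l}_{q,a,q'}$, uncertain-parameter set $\Theta$, belief simplex $\mathcal{B}$, and rational belief update with numerators $S_a$ and denominators $R_a$, as defined in the context. Let $t^*\ge1$ be an integer, $Q_u\subset Q$, $\lambda\in\mathbb{R}$, $g$ a real polynomial in one variable, and $$\mathcal{B}_u^s=\{\,b\in\mathcal{B} : g(b(q))>\lambda\text{ for all }q\in Q_u\,\}.$$ Let the set of initial beliefs be $\mathcal{B}_0=\{b_0\in\mathbb{R}^{Q} : l_i^0(b_0)\le 0,\ i=1,\ldots,n_0\}\subset\mathcal{B}$ with polynomials $l_i^0\in\mathbb{R}[b]$. Suppose there exist a polynomial $B\in\mathbb{R}[t,b]$ of degree $d$, sum-of-squares polynomials $p^u_q\in\Sigma[b]$ ($q\in Q_u$), $p^0_i\in\Sigma[b]$ ($i=1,\ldots,n_0$), $p^\theta_{q,a,q'}\in\Sigma[b,\theta]$ ($(q,a,q')\in T_u$), and constants $s_1,s_2>0$ such that $$B(t^*,b)-\sum_{q\in Q_u}p^u_q(b)\,\big(g(b(q))-\lambda\big)-s_1\in\Sigma[b],$$ $$-B(0,b)+\sum_{i=1}^{n_0}p^0_i(b)\,l^0_i(b)-s_2\in\Sigma[b],$$ and, for all $z\in Z$ and $a\in A$, $$-R_a(b,\theta,z)^d\bigg(B\Big(t,\frac{S_a(b,\theta,z)}{R_a(b,\theta,z)}\Big)-B(t-1,b)-\sum_{(q,a',q')\in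 T_u}p^\theta_{q,a',q'}(b,\theta)\,(\underline{l}_{q,a',q'}-\theta_{q,a',q'})(\overline{l}_{q,a',q'}-\theta_{q,a',q'})\bigg)\in\Sigma[t,b,\theta].$$ Then there is no solution $(b_0,b_1,\ldots,b_{t^*})$ of the belief update equation, for any sequence of actions in $A$, any sequence of observations in $Z$ and any $\theta\in\Theta$, with $b_0\in\mathcal{B}_0$ and $b_{t^*}\in\mathcal{B}_u^s$.
   Context: Notation: $\mathbb{R}[x]$ is the set of real polynomials in the variables $x$, and $\Sigma[x]\subset\mathbb{R}[x]$ is the set of polynomials that are finite sums of squares of polynomials in $\mathbb{R}[x]$. The variables are $t$ (one real variable), $b=(b(q))_{q\in Q}$ and $\theta=(\theta_{q,a,q'})_{(q,a,q')\in T_u}$. Uncertain POMDP: $Q$ is a finite set of states, $A$ a finite set of actions, $Z$ a set of observations, $O:Q\times A\times Z\to[0,1]$ a (known) observation probability function, and $T:Q\times A\times Q\to[0,1]$ a transition probability function, some of whose entries are uncertain. Namely, there is a set $T_u\subset Q\times A\times Q$ of triplets and constants $0\le\underline{l}_{q,a,q'}\le\overline{l}_{q,a,q'}\le 1$ for $(q,a,q')\in T_u$. The uncertain-parameter set is $$\Theta=\{\theta=(\theta_{q,a,q'})_{(q,a,q')\in T_u} : \theta_{q,a,q'}\in[\underline{l}_{q,a,q'},\overline{l}_{q,a,q'}] \text{ for all }(q,a,q')\in T_u\}.$$ Let $T_\theta(q,a,q')=\theta_{q,a,q'}$ if $(q,a,q')\in T_u$, and let $T_\theta(q,a,q')=T(q,a,q')$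 (a given number in $[0,1]$) otherwise. Belief simplex: $\mathcal{B}=\{b\in[0,1]^{Q} : \sum_{q\in Q}b(q)=1\}$. Rational belief update: for $a\in A$ and $z\in Z$, $S_a(b,\theta,z)$ is the vector with entries, polynomial in $(b,\theta)$, $$S_a^{q'}(b,\theta,z)=O(q',a,z)\sum_{q\in Q}T_\theta(q,a,q')\,b(q),\quad q'\in Q,\qquad\text{and}\qquad R_a(b,\theta,z)=\sum_{q'\in Q}S_a^{q'}(b,\theta,z).$$ The degree $d$ of $B$ is its total degree, and $R_a^d\,B(t,S_a/R_a)$ denotes the polynomial in $(t,b,\theta)$ obtained after clearing denominators. Solution: a sequence $(b_0,\ldots,b_{t^*})$ in $\mathcal{B}$ is a solution of the belief update equation for actions $a_0,\ldots,a_{t^*-1}\in A$ (arbitrary switching), observations $z_1,\ldots,z_{t^*}\in Z$ and parameter $\theta\in\Theta$ if, for every $t\in\{1,\ldots,t^*\}$, $R_{a_{t-1}}(b_{t-1},\theta,z_t)\neq 0$ and $b_t=S_{a_{t-1}}(b_{t-1},\theta,z_t)/R_{a_{t-1}}(b_{t-1},\theta,z_t)$. *)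

theory Defs
  imports
    Complex_Main
    "HOL-Library.Poly_Mapping"
    "HOL-Library.FuncSet"
    "HOL-Computational_Algebra.Polynomial"
begin

text \<open>A monomial is a finitely supported exponent vector, a polynomial a finitely supported
  coefficient function on monomials. Addition and multiplication are those of
  \<^theory>\<open>HOL-Library.Poly_Mapping\<close>.\<close>

type_synonym 'v mpoly = "('v \<Rightarrow>\<^sub>0 nat) \<Rightarrow>\<^sub>0 real"

definition Const :: "real \<Rightarrow> 'v mpoly" where
  "Const c = Poly_Mapping.single 0 c"

definition Var :: "'v \<Rightarrow> 'v mpoly" where
  "Var v = Poly_Mapping.single (Poly_Mapping.single v 1) 1"

definition mvars :: "'v mpoly \<Rightarrow> 'v set" where
  "mvars p = (\<Union>m\<in>Poly_Mapping.keys p. Poly_Mapping.keys m)"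

definition polys_in :: "'v set \<Rightarrow> 'v mpoly set" where
  "polys_in V = {p. mvars p \<subseteq> V}"

definition sos_in :: "'v set \<Rightarrow> 'v mpoly set" where
  "sos_in V = {p. \<exists>fs. set fs \<subseteq> polys_in V \<and> p = (\<Sum>f\<leftarrow>fs. f ^ 2)}"

definition monom_degree :: "('v \<Rightarrow>\<^sub>0 nat) \<Rightarrow> nat" where
  "monom_degree m = (\<Sum>v\<in>Poly_Mapping.keys m. Poly_Mapping.lookup m v)"

text \<open>The zero polynomial gets degree 0, as in the library for univariate polynomials.\<close>

definition total_degree :: "'v mpoly \<Rightarrow> nat" where
  "total_degree p = Max (insert 0 (monom_degree ` Poly_Mapping.keys p))"

definition mpoly_eval :: "('v \<Rightarrow> real) \<Rightarrow> 'v mpoly \<Rightarrow> real" where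
  "mpoly_eval x p = (\<Sum>m\<in>Poly_Mapping.keys p. Poly_Mapping.lookup p m *
     (\<Prod>v\<in>Poly_Mapping.keys m. x v ^ Poly_Mapping.lookup m v))"

definition mpoly_subst :: "('v \<Rightarrow> 'w mpoly) \<Rightarrow> 'v mpoly \<Rightarrow> 'w mpoly" where
  "mpoly_subst \<sigma> p = (\<Sum>m\<in>Poly_Mapping.keys p. Const (Poly_Mapping.lookup p m) *
     (\<Prod>v\<in>Poly_Mapping.keys m. \<sigma> v ^ Poly_Mapping.lookup m v))"

text \<open>\<open>g(p)\<close> for a univariate \<open>g\<close> and a multivariate \<open>p\<close>.\<close>

definition upoly_at :: "real poly \<Rightarrow> 'v mpoly \<Rightarrow> 'v mpoly" where
  "upoly_at g p = poly (map_poly Const g) p"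

record ('q, 'a, 'z) pomdp =
  obs :: "'q \<Rightarrow> 'a \<Rightarrow> 'z \<Rightarrow> real"
  trans :: "'q \<Rightarrow> 'a \<Rightarrow> 'q \<Rightarrow> real"
  uncertain :: "('q \<times> 'a \<times> 'q) set"
  lower :: "'q \<times> 'a \<times> 'q \<Rightarrow> real"
  upper :: "'q \<times> 'a \<times> 'q \<Rightarrow> real"

definition uncertain_pomdp :: "('q::finite, 'a::finite, 'z) pomdp \<Rightarrow> bool" where
  "uncertain_pomdp P \<longleftrightarrow>
     (\<forall>q a z. obs P q a z \<in> {0..1}) \<and>
     (\<forall>q a q'. trans P q a q' \<in> {0..1}) \<and>
     (\<forall>k\<in>uncertain P. 0 \<le> lower P k \<and> lower P k \<le> upper P k \<and> upper P k \<le> 1)"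

definition params :: "('q, 'a, 'z) pomdp \<Rightarrow> ('q \<times> 'a \<times> 'q \<Rightarrow> real) set" where
  "params P = (\<Pi>\<^sub>E k\<in>uncertain P. {lower P k..upper P k})"

definition trans_at ::
  "('q, 'a, 'z) pomdp \<Rightarrow> ('q \<times> 'a \<times> 'q \<Rightarrow> real) \<Rightarrow> 'q \<Rightarrow> 'a \<Rightarrow> 'q \<Rightarrow> real" where
  "trans_at P \<theta> q a q' = (if (q, a, q') \<in> uncertain P then \<theta> (q, a, q') else trans P q a q')"

definition beliefs :: "('q::finite \<Rightarrow> real) set" where
  "beliefs = {b. (\<forall>q. b q \<in> {0..1}) \<and> (\<Sum>q\<in>UNIV. b q) = 1}"

definition update_num ::
  "('q::finite, 'a, 'z) pomdp \<Rightarrow> 'a \<Rightarrow> ('q \<Rightarrow> real) \<Rightarrow> ('q \<times> 'a \<times> 'q \<Rightarrow> real) \<Rightarrow> 'z \<Rightarrow> 'q \<Rightarrow> real" where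
  "update_num P a b \<theta> z q' = obs P q' a z * (\<Sum>q\<in>UNIV. trans_at P \<theta> q a q' * b q)"

definition update_den ::
  "('q::finite, 'a, 'z) pomdp \<Rightarrow> 'a \<Rightarrow> ('q \<Rightarrow> real) \<Rightarrow> ('q \<times> 'a \<times> 'q \<Rightarrow> real) \<Rightarrow> 'z \<Rightarrow> real" where
  "update_den P a b \<theta> z = (\<Sum>q'\<in>UNIV. update_num P a b \<theta> z q')"

text \<open>Only \<open>b 0, \<dots>, b N\<close>, \<open>a 0, \<dots>, a (N - 1)\<close> and \<open>z 1, \<dots>, z N\<close> matter.\<close>

definition belief_solution ::
  "('q::finite, 'a, 'z) pomdp \<Rightarrow> nat \<Rightarrow> ('q \<times> 'a \<times> 'q \<Rightarrow> real) \<Rightarrow> (nat \<Rightarrow> 'a) \<Rightarrow> (nat \<Rightarrow> 'z)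
     \<Rightarrow> (nat \<Rightarrow> 'q \<Rightarrow> real) \<Rightarrow> bool" where
  "belief_solution P N \<theta> a z b \<longleftrightarrow>
     (\<forall>t\<in>{0..N}. b t \<in> beliefs) \<and>
     (\<forall>t\<in>{1..N}. update_den P (a (t - 1)) (b (t - 1)) \<theta> (z t) \<noteq> 0 \<and>
        b t = (\<lambda>q'. update_num P (a (t - 1)) (b (t - 1)) \<theta> (z t) q' /
                     update_den P (a (t - 1)) (b (t - 1)) \<theta> (z t)))"

datatype ('q, 'a) var = Time | Bel 'q | Par "'q \<times> 'a \<times> 'q"

abbreviation bel_vars :: "('q, 'a) var set" where
  "bel_vars \<equiv> range Bel"

abbreviation par_vars :: "('q, 'a, 'z) pomdp \<Rightarrow> ('q, 'a) var set" where
  "par_vars P \<equiv> Par ` uncertain P"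

definition initial_beliefs ::
  "nat \<Rightarrow> (nat \<Rightarrow> ('q, 'a) var mpoly) \<Rightarrow> ('q \<Rightarrow> real) set" where
  "initial_beliefs n l =
     {b. \<forall>i\<in>{1..n}. mpoly_eval (\<lambda>v. case v of Bel q \<Rightarrow> b q | _ \<Rightarrow> 0) (l i) \<le> 0}"

definition unsafe_beliefs :: "'q::finite set \<Rightarrow> real poly \<Rightarrow> real \<Rightarrow> ('q \<Rightarrow> real) set" where
  "unsafe_beliefs Qu g lam = {b \<in> beliefs. \<forall>q\<in>Qu. poly g (b q) > lam}"

definition trans_poly ::
  "('q, 'a, 'z) pomdp \<Rightarrow> 'q \<Rightarrow> 'a \<Rightarrow> 'q \<Rightarrow> ('q, 'a) var mpoly" where
  "trans_poly P q a q' =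
     (if (q, a, q') \<in> uncertain P then Var (Par (q, a, q')) else Const (trans P q a q'))"

definition num_poly ::
  "('q::finite, 'a, 'z) pomdp \<Rightarrow> 'a \<Rightarrow> 'z \<Rightarrow> 'q \<Rightarrow> ('q, 'a) var mpoly" where
  "num_poly P a z q' = Const (obs P q' a z) * (\<Sum>q\<in>UNIV. trans_poly P q a q' * Var (Bel q))"

definition den_poly ::
  "('q::finite, 'a, 'z) pomdp \<Rightarrow> 'a \<Rightarrow> 'z \<Rightarrow> ('q, 'a) var mpoly" where
  "den_poly P a z = (\<Sum>q'\<in>UNIV. num_poly P a z q')"

definition subst_time :: "('q, 'a) var mpoly \<Rightarrow> ('q, 'a) var mpoly \<Rightarrow> ('q, 'a) var mpoly" where
  "subst_time u = mpoly_subst (Var(Time := u))"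

text \<open>\<open>R\<^sup>d B(t, S/R)\<close> with denominators cleared: a monomial \<open>t\<^sup>i b\<^sup>\<alpha>\<close> of \<open>B\<close> becomes
  \<open>t\<^sup>i S\<^sup>\<alpha> R\<^bsup>d - |\<alpha>|\<^esup>\<close>. It is meant for \<open>B\<close> in \<open>\<real>[t,b]\<close> and \<open>d\<close> at least the total degree of
  \<open>B\<close>, so that the subtraction does not truncate.\<close>

definition subst_cleared ::
  "nat \<Rightarrow> ('q::finite \<Rightarrow> ('q, 'a) var mpoly) \<Rightarrow> ('q, 'a) var mpoly \<Rightarrow> ('q, 'a) var mpoly
     \<Rightarrow> ('q, 'a) var mpoly" where
  "subst_cleared d S R B = (\<Sum>m\<in>Poly_Mapping.keys B.
     Const (Poly_Mapping.lookup B m) * Var Time ^ Poly_Mapping.lookup m Time *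
     (\<Prod>q\<in>UNIV. S q ^ Poly_Mapping.lookup m (Bel q)) *
     R ^ (d - (\<Sum>q\<in>UNIV. Poly_Mapping.lookup m (Bel q))))"

end

(* A barrier-certificate argument: B (0, b 0) \<le> - s2 on the initial beliefs, and multiplying out by
  the positive power R ^ d shows that B (t, b t) is nonincreasing along a solution, because
  (lower - \<theta>) * (upper - \<theta>) \<le> 0 for admissible \<theta>. But B (tstar, b tstar) \<ge> s1 > 0 on the unsafe
  beliefs. *)

theory Submission
  imports Defs
begin

section \<open>Evaluation of polynomials as a ring homomorphism\<close>

definition monom_eval :: "('v \<Rightarrow> real) \<Rightarrow> ('v \<Rightarrow>\<^sub>0 nat) \<Rightarrow> real" where
  "monom_eval x m = (\<Prod>v\<in>Poly_Mapping.keys m. x v ^ Poly_Mapping.lookup m v)"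

lemma mpoly_eval_monom:
  "mpoly_eval x p = (\<Sum>m\<in>Poly_Mapping.keys p. Poly_Mapping.lookup p m * monom_eval x m)"
  by (simp add: mpoly_eval_def monom_eval_def)

text \<open>Variables outside the support have exponent 0 and contribute the factor 1. This lets
  monomials with different supports be compared over one index set.\<close>

lemma monom_eval_superset:
  assumes "finite V" "Poly_Mapping.keys m \<subseteq> V"
  shows "monom_eval x m = (\<Prod>v\<in>V. x v ^ Poly_Mapping.lookup m v)"
  unfolding monom_eval_def
  by (rule prod.mono_neutral_left) (use assms in \<open>auto simp: in_keys_iff\<close>)

lemma monom_eval_0 [simp]: "monom_eval x 0 = 1"
  by (simp add: monom_eval_def)

lemma monom_eval_add: "monom_eval x (m + n) = monom_eval x m * monom_eval x n"
proof -
  let ?V = "Poly_Mapping.keys m \<union> Poly_Mapping.keys n"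
  have "Poly_Mapping.keys (m + n) \<subseteq> ?V"
    by (rule Poly_Mapping.keys_add)
  then show ?thesis
    by (simp add: monom_eval_superset[of ?V] lookup_add power_add prod.distrib)
qed

lemma mpoly_eval_superset:
  assumes "finite M" "Poly_Mapping.keys p \<subseteq> M"
  shows "mpoly_eval x p = (\<Sum>m\<in>M. Poly_Mapping.lookup p m * monom_eval x m)"
  unfolding mpoly_eval_monom
  by (rule sum.mono_neutral_left) (use assms in \<open>auto simp: in_keys_iff\<close>)

lemma mpoly_eval_0 [simp]: "mpoly_eval x 0 = 0"
  by (simp add: mpoly_eval_def)

lemma mpoly_eval_single [simp]: "mpoly_eval x (Poly_Mapping.single m c) = c * monom_eval x m"
  by (simp add: mpoly_eval_superset[of "{m}"])

lemma mpoly_eval_Const [simp]: "mpoly_eval x (Const c) = c"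
  by (simp add: Const_def)

lemma mpoly_eval_1 [simp]: "mpoly_eval x 1 = 1"
  using mpoly_eval_Const[of x 1] by (simp add: Const_def)

lemma mpoly_eval_Var [simp]: "mpoly_eval x (Var v) = x v"
  by (simp add: Var_def monom_eval_def)

lemma mpoly_eval_add [simp]: "mpoly_eval x (p + q) = mpoly_eval x p + mpoly_eval x q"
proof -
  let ?M = "Poly_Mapping.keys p \<union> Poly_Mapping.keys q"
  have "Poly_Mapping.keys (p + q) \<subseteq> ?M"
    by (rule Poly_Mapping.keys_add)
  then show ?thesis
    by (simp add: mpoly_eval_superset[of ?M] lookup_add algebra_simps sum.distrib)
qed

lemma mpoly_eval_uminus [simp]: "mpoly_eval x (- p) = - mpoly_eval x p"
  using mpoly_eval_add[of x p "- p"] by simp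

lemma mpoly_eval_diff [simp]: "mpoly_eval x (p - q) = mpoly_eval x p - mpoly_eval x q"
  using mpoly_eval_add[of x "p - q" q] by simp

lemma mpoly_eval_sum [simp]: "mpoly_eval x (\<Sum>i\<in>I. f i) = (\<Sum>i\<in>I. mpoly_eval x (f i))"
  by (induction I rule: infinite_finite_induct) auto

text \<open>Multiplicativity is obtained by two inductions, one for each factor. This is the first:
  the left factor is a single term, so that each product of terms is again a single term and
  \<open>monom_eval_add\<close> applies.\<close>

lemma mpoly_eval_single_mult:
  "mpoly_eval x (Poly_Mapping.single m c * q) = c * monom_eval x m * mpoly_eval x q"
proof (induction q rule: Poly_Mapping.update_induct)
  case const
  then show ?case by simp
next
  case (update f a b)
  \<comment> \<open>The key \<open>a\<close> is new to \<open>f\<close>, so the update overwrites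
    nothing and amounts to adding one term.\<close>
  have "Poly_Mapping.update a b f = f + Poly_Mapping.single a b"
    using update
    by (intro poly_mapping_eqI) (auto simp: lookup_update lookup_add lookup_single in_keys_iff)
  then show ?case
    using update by (simp add: distrib_left mult_single monom_eval_add algebra_simps)
qed

lemma mpoly_eval_mult [simp]: "mpoly_eval x (p * q) = mpoly_eval x p * mpoly_eval x q"
proof (induction p rule: Poly_Mapping.update_induct)
  case const
  then show ?case by simp
next
  case (update f a b)
  have "Poly_Mapping.update a b f = f + Poly_Mapping.single a b"
    using update
    by (intro poly_mapping_eqI) (auto simp: lookup_update lookup_add lookup_single in_keys_iff)
  then show ?case
    using update by (simp add: distrib_right mpoly_eval_single_mult)
qed

lemma mpoly_eval_power [simp]: "mpoly_eval x (p ^ n) = mpoly_eval x p ^ n"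
  by (induction n) auto

lemma mpoly_eval_prod [simp]: "mpoly_eval x (\<Prod>i\<in>I. f i) = (\<Prod>i\<in>I. mpoly_eval x (f i))"
  by (induction I rule: infinite_finite_induct) auto

lemma mpoly_eval_subst: "mpoly_eval x (mpoly_subst \<sigma> p) = mpoly_eval (\<lambda>v. mpoly_eval x (\<sigma> v)) p"
  by (simp add: mpoly_subst_def mpoly_eval_def[of _ p])

lemma mpoly_eval_upoly_at [simp]: "mpoly_eval x (upoly_at g p) = poly g (mpoly_eval x p)"
proof -
  \<comment> \<open>\<open>map_poly\<close> commutes with \<open>pCons\<close> only for a
    coefficient map that preserves 0.\<close>
  have "Const 0 = (0 :: 'a mpoly)"
    by (simp add: Const_def)
  then show ?thesis
    unfolding upoly_at_def by (induction g) (auto simp: map_poly_pCons)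
qed

lemma mpoly_eval_cong:
  assumes "p \<in> polys_in V" "\<And>v. v \<in> V \<Longrightarrow> x v = y v"
  shows "mpoly_eval x p = mpoly_eval y p"
  unfolding mpoly_eval_def
  using assms by (intro sum.cong prod.cong arg_cong2[where f = "(*)"])
    (auto simp: polys_in_def mvars_def subset_iff)

lemma mpoly_eval_sos_nonneg:
  assumes "p \<in> sos_in V"
  shows "mpoly_eval x p \<ge> 0"
proof -
  have "mpoly_eval x (\<Sum>f\<leftarrow>fs. f ^ 2) \<ge> 0" for fs
    by (induction fs) auto
  then show ?thesis
    using assms by (auto simp: sos_in_def)
qed

section \<open>Evaluation at a time, a belief and a parameter, and the clearing of
  denominators\<close>

primrec assignment ::
  "real \<Rightarrow> ('q \<Rightarrow> real) \<Rightarrow> ('q \<times> 'a \<times> 'q \<Rightarrow> real) \<Rightarrow> ('q, 'a) var \<Rightarrow> real" where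
  "assignment t b \<theta> Time = t"
| "assignment t b \<theta> (Bel q) = b q"
| "assignment t b \<theta> (Par k) = \<theta> k"

lemma mpoly_eval_subst_time [simp]:
  "mpoly_eval (assignment t b \<theta>) (subst_time u p) =
     mpoly_eval (assignment (mpoly_eval (assignment t b \<theta>) u) b \<theta>) p"
proof -
  have "(\<lambda>v. mpoly_eval (assignment t b \<theta>) ((Var(Time := u)) v)) =
      assignment (mpoly_eval (assignment t b \<theta>) u) b \<theta>" (is "?x = ?y")
  proof
    show "?x v = ?y v" for v by (cases v) auto
  qed
  then show ?thesis
    by (simp add: subst_time_def mpoly_eval_subst)
qed

text \<open>Brings the value of a monomial into the shape in which \<open>subst_cleared\<close>
  treats it: the time power apart, the belief powers over all states.\<close>

lemma monom_eval_assignment: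
  fixes m :: "('q::finite, 'a) var \<Rightarrow>\<^sub>0 nat"
  assumes "Poly_Mapping.keys m \<subseteq> {Time} \<union> bel_vars"
  shows "monom_eval (assignment t b \<theta>) m =
    t ^ Poly_Mapping.lookup m Time * (\<Prod>q\<in>UNIV. b q ^ Poly_Mapping.lookup m (Bel q))"
proof -
  have "Time \<notin> (bel_vars :: ('q, 'a) var set)" "inj (Bel :: 'q \<Rightarrow> ('q, 'a) var)"
    by (auto simp: inj_on_def)
  then show ?thesis
    using assms
    by (subst monom_eval_superset[of "insert Time bel_vars"]) (simp_all add: prod.reindex)
qed

text \<open>The other variables can only add to the degree. The bound ensures that the exponent of
  \<open>R\<close> in \<open>subst_cleared\<close> is a true difference.\<close>

lemma bel_degree_le_total_degree:
  fixes p :: "('q::finite, 'a) var mpoly"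
  assumes "m \<in> Poly_Mapping.keys p"
  shows "(\<Sum>q\<in>UNIV. Poly_Mapping.lookup m (Bel q)) \<le> total_degree p"
proof -
  have "(\<Sum>q\<in>UNIV. Poly_Mapping.lookup m (Bel q)) = (\<Sum>v\<in>bel_vars. Poly_Mapping.lookup m v)"
    by (simp add: sum.reindex inj_on_def)
  also have "\<dots> \<le> (\<Sum>v\<in>bel_vars \<union> Poly_Mapping.keys m. Poly_Mapping.lookup m v)"
    by (intro sum_mono2) auto
  also have "\<dots> = monom_degree m"
    unfolding monom_degree_def by (intro sum.mono_neutral_right) (auto simp: in_keys_iff)
  also have "\<dots> \<le> total_degree p"
    unfolding total_degree_def using assms by (intro Max_ge) auto
  finally show ?thesis .
qed

text \<open>Holds monomial by monomial: if \<open>e\<close> is the degree of the monomial in the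
  belief variables, then \<open>e\<close> \<le> \<open>d\<close> and a nonzero value
  \<open>r\<close> of \<open>R\<close> give \<open>r ^ (d - e) = r ^ d / r ^ e\<close>, and the
  factor \<open>1 / r ^ e\<close> spreads over the \<open>e\<close> belief factors.\<close>

lemma mpoly_eval_subst_cleared:
  fixes B :: "('q::finite, 'a) var mpoly"
  assumes B: "B \<in> polys_in ({Time} \<union> bel_vars)" and d: "total_degree B \<le> d"
    and R: "mpoly_eval (assignment t b \<theta>) R \<noteq> 0"
  shows "mpoly_eval (assignment t b \<theta>) (subst_cleared d S R B) =
    mpoly_eval (assignment t b \<theta>) R ^ d *
    mpoly_eval (assignment t (\<lambda>q. mpoly_eval (assignment t b \<theta>) (S q) /
      mpoly_eval (assignment t b \<theta>) R) \<theta>) B"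
proof -
  define r where "r = mpoly_eval (assignment t b \<theta>) R"
  define s where "s q = mpoly_eval (assignment t b \<theta>) (S q)" for q
  have "(\<Prod>q\<in>UNIV. s q ^ Poly_Mapping.lookup m (Bel q)) *
      r ^ (d - (\<Sum>q\<in>UNIV. Poly_Mapping.lookup m (Bel q))) =
      r ^ d * (\<Prod>q\<in>UNIV. (s q / r) ^ Poly_Mapping.lookup m (Bel q))"
    if "m \<in> Poly_Mapping.keys B" for m
  proof -
    have "(\<Sum>q\<in>UNIV. Poly_Mapping.lookup m (Bel q)) \<le> d"
      using bel_degree_le_total_degree[OF that] d by linarith
    then show ?thesis
      using R by (simp add: r_def power_divide prod_dividef power_sum[symmetric] power_diff)
  qed
  moreover have "Poly_Mapping.keys m \<subseteq> {Time} \<union> bel_vars" if "m \<in> Poly_Mapping.keys B" for m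
    using B that unfolding polys_in_def mvars_def by blast
  ultimately show ?thesis
    unfolding mpoly_eval_monom[of _ B] subst_cleared_def sum_distrib_left
      r_def[symmetric] s_def[symmetric]
    by (simp add: monom_eval_assignment r_def[symmetric] s_def[symmetric] mult.assoc
        mult.left_commute[of "r ^ d"])
qed

section \<open>Values of the update polynomials and the sign of the denominator\<close>

lemma mpoly_eval_num_poly [simp]:
  "mpoly_eval (assignment t b \<theta>) (num_poly P a z q') = update_num P a b \<theta> z q'"
proof -
  have "mpoly_eval (assignment t b \<theta>) (trans_poly P q a q') = trans_at P \<theta> q a q'" for q
    by (simp add: trans_poly_def trans_at_def)
  then show ?thesis
    by (simp add: num_poly_def update_num_def)
qed

lemma mpoly_eval_den_poly [simp]:
  "mpoly_eval (assignment t b \<theta>) (den_poly P a z) = update_den P a b \<theta> z"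
  by (simp add: den_poly_def update_den_def)

text \<open>Every factor is nonnegative; for an uncertain transition this comes from 0 \<le>
  \<open>lower\<close> \<le> \<theta>. Along a solution, where the denominator is nonzero, it is
  therefore positive.\<close>

lemma update_den_nonneg:
  assumes "uncertain_pomdp P" "\<theta> \<in> params P" "b \<in> beliefs"
  shows "update_den P a b \<theta> z \<ge> 0"
proof -
  have "trans_at P \<theta> q a q' \<ge> 0" for q q'
  proof (cases "(q, a, q') \<in> uncertain P")
    case True
    then have "0 \<le> lower P (q, a, q')" "lower P (q, a, q') \<le> \<theta> (q, a, q')"
      using assms by (auto simp: uncertain_pomdp_def params_def)
    then show ?thesis
      using True by (simp add: trans_at_def)
  next
    case False
    then show ?thesis
      using assms by (simp add: uncertain_pomdp_def trans_at_def)
  qed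
  moreover have "b q \<ge> 0" for q
    using assms by (simp add: beliefs_def)
  moreover have "obs P q a z \<ge> 0" for q
    using assms by (simp add: uncertain_pomdp_def)
  ultimately show ?thesis
    unfolding update_den_def update_num_def by (intro sum_nonneg mult_nonneg_nonneg)
qed

section \<open>Descent of the barrier polynomial along a solution\<close>

theorem corollary2:
  fixes P :: "('q::finite, 'a::finite, 'z) pomdp"
    and tstar n0 d :: nat
    and Qu :: "'q set"
    and lam s1 s2 :: real
    and g :: "real poly"
    and l p0 :: "nat \<Rightarrow> ('q, 'a) var mpoly"
    and B :: "('q, 'a) var mpoly"
    and pu :: "'q \<Rightarrow> ('q, 'a) var mpoly"
    and p\<theta> :: "'q \<times> 'a \<times> 'q \<Rightarrow> ('q, 'a) var mpoly"
  assumes "uncertain_pomdp P"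
    and "tstar \<ge> 1"
    and "\<forall>i\<in>{1..n0}. l i \<in> polys_in bel_vars"
    and "initial_beliefs n0 l \<subseteq> beliefs"
    and "B \<in> polys_in ({Time} \<union> bel_vars)"
    and "d = total_degree B"
    and "\<forall>q\<in>Qu. pu q \<in> sos_in bel_vars"
    and "\<forall>i\<in>{1..n0}. p0 i \<in> sos_in bel_vars"
    and "\<forall>k\<in>uncertain P. p\<theta> k \<in> sos_in (bel_vars \<union> par_vars P)"
    and "s1 > 0" and "s2 > 0"
    and "subst_time (Const (real tstar)) B
           - (\<Sum>q\<in>Qu. pu q * (upoly_at g (Var (Bel q)) - Const lam)) - Const s1
         \<in> sos_in bel_vars"
    and "- subst_time (Const 0) B + (\<Sum>i=1..n0. p0 i * l i) - Const s2 \<in> sos_in bel_vars"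
    and "\<forall>z a. - (subst_cleared d (num_poly P a z) (den_poly P a z) B
                   - den_poly P a z ^ d * subst_time (Var Time - Const 1) B
                   - den_poly P a z ^ d *
                       (\<Sum>k\<in>uncertain P. p\<theta> k * (Const (lower P k) - Var (Par k))
                                                * (Const (upper P k) - Var (Par k))))
           \<in> sos_in ({Time} \<union> bel_vars \<union> par_vars P)"
  shows "\<not> (\<exists>b a z \<theta>. \<theta> \<in> params P \<and> belief_solution P tstar \<theta> a z b \<and>
              b 0 \<in> initial_beliefs n0 l \<and> b tstar \<in> unsafe_beliefs Qu g lam)"
proof
  let ?ev = "\<lambda>t b \<theta>. mpoly_eval (assignment t b \<theta>)"
  assume "\<exists>b a z \<theta>. \<theta> \<in> params P \<and> belief_solution P tstar \<theta> a z b \<and>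
    b 0 \<in> initial_beliefs n0 l \<and> b tstar \<in> unsafe_beliefs Qu g lam"
  then obtain b a z \<theta> where \<theta>: "\<theta> \<in> params P" and sol: "belief_solution P tstar \<theta> a z b"
    and init: "b 0 \<in> initial_beliefs n0 l" and unsafe: "b tstar \<in> unsafe_beliefs Qu g lam"
    by blast
  have initial: "?ev 0 (b 0) \<theta> B \<le> - s2"
  proof -
    have "?ev 0 (b 0) \<theta> (p0 i) * ?ev 0 (b 0) \<theta> (l i) \<le> 0" if i: "i \<in> {1..n0}" for i
    proof (rule mult_nonneg_nonpos)
      show "?ev 0 (b 0) \<theta> (p0 i) \<ge> 0"
        using assms(8) i mpoly_eval_sos_nonneg by blast
      \<comment> \<open>The two points differ only outside the belief variables, where
        \<open>initial_beliefs\<close> uses the default 0, and \<open>l i\<close> involves belief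
        variables only.\<close>
      have "?ev 0 (b 0) \<theta> (l i) = mpoly_eval (\<lambda>v. case v of Bel q \<Rightarrow> b 0 q | _ \<Rightarrow> 0) (l i)"
        using assms(3) i by (intro mpoly_eval_cong[of _ bel_vars]) auto
      then show "?ev 0 (b 0) \<theta> (l i) \<le> 0"
        using init i by (simp add: initial_beliefs_def)
    qed
    then have "(\<Sum>i=1..n0. ?ev 0 (b 0) \<theta> (p0 i) * ?ev 0 (b 0) \<theta> (l i)) \<le> 0"
      by (rule sum_nonpos)
    then show ?thesis
      using mpoly_eval_sos_nonneg[OF assms(13), of "assignment 0 (b 0) \<theta>"] by simp
  qed
  have step: "?ev (real (Suc n)) (b (Suc n)) \<theta> B \<le> ?ev (real n) (b n) \<theta> B"
    if n: "n < tstar" for n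
  proof -
    define r where "r = update_den P (a n) (b n) \<theta> (z (Suc n))"
    \<comment> \<open>The time is already \<open>Suc n\<close>, the belief still \<open>b n\<close>.
      At this one point the update polynomials produce \<open>b (Suc n)\<close>, while replacing
      time by \<open>Var Time - Const 1\<close> leads back to time \<open>n\<close>; both values of
      \<open>B\<close> to be compared thus appear.\<close>
    let ?e = "?ev (real (Suc n)) (b n) \<theta>"
    have bn: "b n \<in> beliefs"
      using sol n by (simp add: belief_solution_def)
    have Suc_n: "Suc n \<in> {1..tstar}"
      using n by simp
    then have r0: "r \<noteq> 0"
      and bSuc: "b (Suc n) = (\<lambda>q. update_num P (a n) (b n) \<theta> (z (Suc n)) q / r)"
      using sol unfolding belief_solution_def r_def by (metis diff_Suc_1)+
    have r: "r > 0"
      using update_den_nonneg[OF assms(1) \<theta> bn] r0 by (simp add: r_def less_le)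
    have cleared: "?e (subst_cleared d (num_poly P (a n) (z (Suc n)))
        (den_poly P (a n) (z (Suc n))) B) = r ^ d * ?ev (real (Suc n)) (b (Suc n)) \<theta> B"
      using r0 assms(5,6) by (subst mpoly_eval_subst_cleared) (simp_all add: r_def[symmetric] bSuc)
    have "?e (p\<theta> k) * (lower P k - \<theta> k) * (upper P k - \<theta> k) \<le> 0" if k: "k \<in> uncertain P" for k
    proof -
      have "?e (p\<theta> k) \<ge> 0"
        using assms(9) k mpoly_eval_sos_nonneg by blast
      \<comment> \<open>An admissible parameter lies between its bounds, so the two factors have
        opposite signs.\<close>
      moreover have "lower P k - \<theta> k \<le> 0" "upper P k - \<theta> k \<ge> 0"
        using \<theta> k by (auto simp: params_def)
      ultimately show ?thesis
        by (meson mult_nonneg_nonpos mult_nonpos_nonneg)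
    qed
    then have penalty:
      "(\<Sum>k\<in>uncertain P. ?e (p\<theta> k) * (lower P k - \<theta> k) * (upper P k - \<theta> k)) \<le> 0"
      by (rule sum_nonpos)
    \<comment> \<open>This is the third certificate evaluated at the point of \<open>?e\<close>. All
      three terms carry the same positive factor \<open>r ^ d\<close>, which can be cancelled once
      the penalty is known to be nonpositive.\<close>
    have "r ^ d * ?ev (real (Suc n)) (b (Suc n)) \<theta> B - r ^ d * ?ev (real n) (b n) \<theta> B \<le>
        r ^ d * (\<Sum>k\<in>uncertain P. ?e (p\<theta> k) * (lower P k - \<theta> k) * (upper P k - \<theta> k))"
      using mpoly_eval_sos_nonneg[OF assms(14)[rule_format, of "a n" "z (Suc n)"],
          of "assignment (real (Suc n)) (b n) \<theta>"] cleared
      by (simp add: r_def[symmetric])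
    also have "\<dots> \<le> 0"
      using r penalty by (intro mult_nonneg_nonpos) auto
    finally show ?thesis
      using r by simp
  qed
  have "n \<le> tstar \<Longrightarrow> ?ev (real n) (b n) \<theta> B \<le> - s2" for n
  proof (induction n)
    case 0
    then show ?case using initial by simp
  next
    case (Suc n)
    then show ?case using step[of n] by simp
  qed
  then have "?ev (real tstar) (b tstar) \<theta> B \<le> - s2"
    by simp
  moreover have "?ev (real tstar) (b tstar) \<theta> B \<ge> s1"
  proof -
    \<comment> \<open>The time 0 is an arbitrary choice: in the certificate
      \<open>subst_time\<close> has already put \<open>tstar\<close> in place of the time variable,
      and a sum of squares is nonnegative at every point.\<close>
    have "?ev 0 (b tstar) \<theta> (pu q) * (poly g (b tstar q) - lam) \<ge> 0" if "q \<in> Qu" for q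
      using assms(7) that unsafe
      by (intro mult_nonneg_nonneg)
        (auto simp: unsafe_beliefs_def less_imp_le intro: mpoly_eval_sos_nonneg)
    then have "(\<Sum>q\<in>Qu. ?ev 0 (b tstar) \<theta> (pu q) * (poly g (b tstar q) - lam)) \<ge> 0"
      by (rule sum_nonneg)
    then show ?thesis
      using mpoly_eval_sos_nonneg[OF assms(12), of "assignment 0 (b tstar) \<theta>"] by simp
  qed
  ultimately show False
    using assms(10,11) by linarith
qed

end
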